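(* Let $W$ be a simply-laced Coxeter group with Coxeter graph $S$. Then the center $Z(\mathbf{W})$ of the flipping group $\mathbf{W}$ of $S$ is trivial.
   Context: A simply-laced Coxeter group $W$ is the group with a finite set of generators $S$, $|S|=n$, subject only to the relations $(ss')^{m(s,s')}=1$ for $s,s'\in S$, where $m(s,s)=1$ and $m(s,s')=m(s',s)\in\{2,3\}$ for $s\neq s'$. Its Coxeter graph (also denoted $S$) has vertex set $S$ and edge set $R=\{ss' : m(s,s')=3\}$. $F_2$ is the field with two elements. For $s\in S$, $\mathbf{s}$ denotes the $n\times n$ matrix over $F_2$, with rows and columns indexed by $S$, whose entries are $\mathbf{s}_{uv}=1$ if $u=v$, or if $v=s$ and $uv\in R$, and $\mathbf{s}_{uv}=0$ otherwise. One has $\mathbf{s}^2=I$, so $\mathbf{s}$ is invertible. The flipping group $\mathbf{W}$ of $S$ is the subgroup of $\mathrm{GL}_n(F_2)$ generated by $\{\mathbf{s} : s\in S\}$. *)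

theory Defs
  imports "HOL-Algebra.Algebra" "HOL-Library.Z2"
begin

(* One elementary rewriting of words in S: delete a factor (s t)^(m s t). *)
inductive coxeter_step :: "'a set \<Rightarrow> ('a \<Rightarrow> 'a \<Rightarrow> nat) \<Rightarrow> 'a list \<Rightarrow> 'a list \<Rightarrow> bool"
  for S m where
  "\<lbrakk>s \<in> S; t \<in> S; set u \<subseteq> S; set v \<subseteq> S\<rbrakk> \<Longrightarrow>
    coxeter_step S m (u @ concat (replicate (m s t) [s, t]) @ v) (u @ v)"

(* "Generated by S, subject only to the relations (s t)^(m s t) = 1": every element is a
   product of generators, and a word evaluates to 1 exactly when the defining relations
   transform it into the empty word.  Since m s s = 1 makes every generator its own
   inverse, words without formal inverses suffice to present the group. *)
locale simply_laced_coxeter_group = group W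
  for W :: "('a, 'b) monoid_scheme" (structure) +
  fixes S :: "'a set" and m :: "'a \<Rightarrow> 'a \<Rightarrow> nat"
  assumes finite_gens: "finite S"
    and gens_in_carrier: "S \<subseteq> carrier W"
    and m_diag: "s \<in> S \<Longrightarrow> m s s = 1"
    and m_sym: "\<lbrakk>s \<in> S; t \<in> S\<rbrakk> \<Longrightarrow> m s t = m t s"
    and m_off_diag: "\<lbrakk>s \<in> S; t \<in> S; s \<noteq> t\<rbrakk> \<Longrightarrow> m s t \<in> {2, 3}"
    and generated: "generate W S = carrier W"
    and presented: "w \<in> lists S \<Longrightarrow>
      foldr (\<otimes>) w \<one> = \<one> \<longleftrightarrow> equivclp (coxeter_step S m) w []"

definition coxeter_edges :: "'a set \<Rightarrow> ('a \<Rightarrow> 'a \<Rightarrow> nat) \<Rightarrow> 'a set set" where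
  "coxeter_edges S m = {{s, t} | s t. s \<in> S \<and> t \<in> S \<and> m s t = 3}"

(* Square matrices over F_2 with rows and columns indexed by S; the functions are
   extensional, so that matrices are equal as soon as their entries on S are. *)
definition F2_matrices :: "'a set \<Rightarrow> ('a \<Rightarrow> 'a \<Rightarrow> bit) monoid" where
  "F2_matrices S =
    \<lparr>carrier = S \<rightarrow>\<^sub>E (S \<rightarrow>\<^sub>E UNIV),
     monoid.mult = (\<lambda>A B. \<lambda>u\<in>S. \<lambda>v\<in>S. \<Sum>x\<in>S. A u x * B x v),
     one = (\<lambda>u\<in>S. \<lambda>v\<in>S. if u = v then 1 else 0)\<rparr>"

definition GL_F2 :: "'a set \<Rightarrow> ('a \<Rightarrow> 'a \<Rightarrow> bit) monoid" where
  "GL_F2 S = units_of (F2_matrices S)"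

definition flip_matrix :: "'a set \<Rightarrow> ('a \<Rightarrow> 'a \<Rightarrow> nat) \<Rightarrow> 'a \<Rightarrow> 'a \<Rightarrow> 'a \<Rightarrow> bit" where
  "flip_matrix S m s =
    (\<lambda>u\<in>S. \<lambda>v\<in>S. if u = v \<or> (v = s \<and> {u, v} \<in> coxeter_edges S m) then 1 else 0)"

definition flipping_group :: "'a set \<Rightarrow> ('a \<Rightarrow> 'a \<Rightarrow> nat) \<Rightarrow> ('a \<Rightarrow> 'a \<Rightarrow> bit) monoid" where
  "flipping_group S m =
    (GL_F2 S)\<lparr>carrier := generate (GL_F2 S) (flip_matrix S m ` S)\<rparr>"

definition group_center :: "('a, 'b) monoid_scheme \<Rightarrow> 'a set" where
  "group_center G = {z \<in> carrier G. \<forall>x \<in> carrier G. z \<otimes>\<^bsub>G\<^esub> x = x \<otimes>\<^bsub>G\<^esub> z}"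

end

(* Write s = I + N_s, where N_s has the neighbours of s as its only nonzero column, namely
   column s.  Comparing entries of z N_s = N_s z in a row u adjacent to s shows that row s of z
   vanishes off the diagonal, so it is the unit row since z is invertible.  If s is isolated,
   then row s of every generator, hence of every element of the group, is the unit row. *)
theory Submission
  imports Defs
begin

(* These rules turn + and * on bit into bitwise operations and so defeat ring rewriting. *)
declare add_bit_eq_xor [simp del] mult_bit_eq_and [simp del]

lemma F2_matrices_simps:
  "carrier (F2_matrices S) = S \<rightarrow>\<^sub>E (S \<rightarrow>\<^sub>E UNIV)"
  "A \<otimes>\<^bsub>F2_matrices S\<^esub> B = (\<lambda>u\<in>S. \<lambda>v\<in>S. \<Sum>x\<in>S. A u x * B x v)"
  "\<one>\<^bsub>F2_matrices S\<^esub> = (\<lambda>u\<in>S. \<lambda>v\<in>S. of_bool (u = v))"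
  by (auto simp: F2_matrices_def of_bool_def)

lemma F2_matrices_eqI:
  assumes "A \<in> carrier (F2_matrices S)" "B \<in> carrier (F2_matrices S)"
    and "\<And>u v. u \<in> S \<Longrightarrow> v \<in> S \<Longrightarrow> A u v = B u v"
  shows "A = B"
proof (rule PiE_ext)
  show "A \<in> S \<rightarrow>\<^sub>E (S \<rightarrow>\<^sub>E UNIV)" "B \<in> S \<rightarrow>\<^sub>E (S \<rightarrow>\<^sub>E UNIV)"
    using assms(1,2) by (simp_all add: F2_matrices_simps)
  then show "A u = B u" if "u \<in> S" for u
    using that assms(3) by (intro PiE_ext[of "A u" S "\<lambda>_. UNIV" "B u"]) auto
qed

lemma sum_of_bool_mult:
  fixes f :: "'a \<Rightarrow> 'b::semiring_1"
  assumes "finite S" "u \<in> S"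
  shows "(\<Sum>x\<in>S. of_bool (u = x) * f x) = f u" "(\<Sum>x\<in>S. f x * of_bool (x = u)) = f u"
  using assms by (simp_all add: of_bool_def if_distrib if_distribR cong: if_cong)

lemma monoid_F2_matrices:
  assumes "finite S"
  shows "Group.monoid (F2_matrices S)"
proof (rule Group.monoidI)
  fix A B C :: "'a \<Rightarrow> 'a \<Rightarrow> bit"
  show "A \<otimes>\<^bsub>F2_matrices S\<^esub> B \<in> carrier (F2_matrices S)" for A B
    by (auto simp: F2_matrices_simps)
  show "\<one>\<^bsub>F2_matrices S\<^esub> \<in> carrier (F2_matrices S)"
    by (auto simp: F2_matrices_simps)
  show "A \<otimes>\<^bsub>F2_matrices S\<^esub> B \<otimes>\<^bsub>F2_matrices S\<^esub> C = A \<otimes>\<^bsub>F2_matrices S\<^esub> (B \<otimes>\<^bsub>F2_matrices S\<^esub> C)"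
  proof (rule F2_matrices_eqI[where S = S])
    fix u v assume "u \<in> S" "v \<in> S"
    then show "(A \<otimes>\<^bsub>F2_matrices S\<^esub> B \<otimes>\<^bsub>F2_matrices S\<^esub> C) u v = (A \<otimes>\<^bsub>F2_matrices S\<^esub> (B \<otimes>\<^bsub>F2_matrices S\<^esub> C)) u v"
      \<comment> \<open>Once products are distributed over sums, the two sides differ only in the
        order of the double summation.\<close>
      using sum.swap[of "\<lambda>x y. A u y * B y x * C x v" S S]
      by (simp add: F2_matrices_simps sum_distrib_left sum_distrib_right mult.assoc)
  qed (auto simp: F2_matrices_simps)
  assume A: "A \<in> carrier (F2_matrices S)"
  show "\<one>\<^bsub>F2_matrices S\<^esub> \<otimes>\<^bsub>F2_matrices S\<^esub> A = A"
    using A assms by (intro F2_matrices_eqI) (auto simp: F2_matrices_simps sum_of_bool_mult)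
  show "A \<otimes>\<^bsub>F2_matrices S\<^esub> \<one>\<^bsub>F2_matrices S\<^esub> = A"
    using A assms by (intro F2_matrices_eqI) (auto simp: F2_matrices_simps sum_of_bool_mult)
qed

lemma GL_F2_simps:
  "carrier (GL_F2 S) = Units (F2_matrices S)"
  "A \<otimes>\<^bsub>GL_F2 S\<^esub> B = A \<otimes>\<^bsub>F2_matrices S\<^esub> B"
  "\<one>\<^bsub>GL_F2 S\<^esub> = \<one>\<^bsub>F2_matrices S\<^esub>"
  by (simp_all add: GL_F2_def units_of_def)

lemma group_GL_F2: "finite S \<Longrightarrow> group (GL_F2 S)"
  unfolding GL_F2_def by (rule monoid.units_group[OF monoid_F2_matrices])

context simply_laced_coxeter_group
begin

lemma edge_irrefl: "{s, s} \<notin> coxeter_edges S m"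
  using m_diag by (fastforce simp: coxeter_edges_def)

text \<open>There are no loops, so the two alternatives in \<open>flip_matrix\<close> exclude each
  other and the disjunction becomes a sum. This additive form lets matrix products be expanded by
  distributivity.\<close>

lemma flip_matrix_entry:
  assumes "u \<in> S" "v \<in> S"
  shows "flip_matrix S m s u v = of_bool (u = v) + of_bool ({u, s} \<in> coxeter_edges S m) * of_bool (v = s)"
  using assms edge_irrefl by (auto simp: flip_matrix_def)

text \<open>Left multiplication acts on rows: row s is added to each row indexed by a neighbour of
  s.\<close>

lemma flip_matrix_mult_left:
  assumes "s \<in> S" "u \<in> S" "v \<in> S"
  shows "(flip_matrix S m s \<otimes>\<^bsub>F2_matrices S\<^esub> A) u v
    = A u v + of_bool ({u, s} \<in> coxeter_edges S m) * A s v"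
proof -
  \<comment> \<open>The equation is oriented as \<open>s = x\<close> in the second sum, so that
    \<open>sum_of_bool_mult\<close> collapses both sums.\<close>
  have "(flip_matrix S m s \<otimes>\<^bsub>F2_matrices S\<^esub> A) u v
    = (\<Sum>x\<in>S. of_bool (u = x) * A x v)
      + of_bool ({u, s} \<in> coxeter_edges S m) * (\<Sum>x\<in>S. of_bool (s = x) * A x v)"
    using assms
    by (simp add: F2_matrices_simps flip_matrix_entry distrib_right sum.distrib
        sum_distrib_left mult.assoc eq_commute[of _ s] del: sum_of_bool_mult_eq sum_mult_of_bool_eq)
  then show ?thesis
    using assms finite_gens by (simp only: sum_of_bool_mult)
qed

text \<open>Right multiplication acts on columns, and only column s of the generator differs from
  the identity.\<close>

lemma flip_matrix_mult_right:
  assumes "u \<in> S" "v \<in> S" "v \<noteq> s"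
  shows "(A \<otimes>\<^bsub>F2_matrices S\<^esub> flip_matrix S m s) u v = A u v"
  using assms finite_gens
  by (simp add: F2_matrices_simps flip_matrix_entry sum_of_bool_mult)

text \<open>Without a loop at s, row s of the generator is a unit row. Applying the generator to
  itself therefore adds this row a second time to the rows of the neighbours of s, which cancels in
  characteristic 2.\<close>

lemma flip_matrix_square:
  assumes "s \<in> S"
  shows "flip_matrix S m s \<otimes>\<^bsub>F2_matrices S\<^esub> flip_matrix S m s = \<one>\<^bsub>F2_matrices S\<^esub>"
proof (rule F2_matrices_eqI[where S = S])
  fix u v assume "u \<in> S" "v \<in> S"
  then show "(flip_matrix S m s \<otimes>\<^bsub>F2_matrices S\<^esub> flip_matrix S m s) u v = \<one>\<^bsub>F2_matrices S\<^esub> u v"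
    using assms edge_irrefl
    by (simp add: flip_matrix_mult_left flip_matrix_entry) (auto simp: F2_matrices_simps)
qed (auto simp: F2_matrices_simps)

lemma flip_matrix_Units:
  assumes "s \<in> S"
  shows "flip_matrix S m s \<in> Units (F2_matrices S)"
proof -
  have "flip_matrix S m s \<in> carrier (F2_matrices S)"
    by (auto simp: flip_matrix_def F2_matrices_simps)
  then show ?thesis
    using flip_matrix_square[OF assms] by (auto simp: Units_def)
qed

lemma inv_flip_matrix:
  assumes "s \<in> S"
  shows "inv\<^bsub>GL_F2 S\<^esub> flip_matrix S m s = flip_matrix S m s"
  using assms flip_matrix_square flip_matrix_Units
  by (intro group.inv_equality[OF group_GL_F2[OF finite_gens]]) (simp_all add: GL_F2_simps)

lemma flipping_group_subset_Units:
  "generate (GL_F2 S) (flip_matrix S m ` S) \<subseteq> Units (F2_matrices S)"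
  using group.generate_incl[OF group_GL_F2[OF finite_gens]] flip_matrix_Units
  by (metis GL_F2_simps(1) image_subsetI)

lemma isolated_row:
  assumes "z \<in> generate (GL_F2 S) (flip_matrix S m ` S)"
    and u: "u \<in> S" "\<And>s. s \<in> S \<Longrightarrow> {u, s} \<notin> coxeter_edges S m" and "v \<in> S"
  shows "z u v = of_bool (u = v)"
  using assms(1) \<open>v \<in> S\<close>
\<comment> \<open>The product case needs the whole row \<open>u\<close> of \<open>h1\<close>, hence
  the claim for all \<open>v\<close> at once: if that row is the unit row, then row \<open>u\<close>
  of the product is row \<open>u\<close> of \<open>h2\<close>.\<close>
proof (induction arbitrary: v rule: generate.induct)
  case one
  then show ?case using u by (simp add: GL_F2_simps F2_matrices_simps)
next
  case (incl h)
  then show ?case using u by (auto simp: flip_matrix_entry)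
next
  case (inv h)
  then show ?case using u by (auto simp: flip_matrix_entry inv_flip_matrix)
next
  case (eng h1 h2)
  have "(h1 \<otimes>\<^bsub>GL_F2 S\<^esub> h2) u v = (\<Sum>x\<in>S. of_bool (u = x) * h2 x v)"
    using u eng by (simp add: GL_F2_simps F2_matrices_simps)
  also have "\<dots> = h2 u v"
    using u(1) finite_gens by (rule sum_of_bool_mult(1)[rotated])
  finally show ?case using eng by simp
qed

lemma nonisolated_row:
  assumes z: "z \<in> Units (F2_matrices S)"
    and comm: "z \<otimes>\<^bsub>F2_matrices S\<^esub> flip_matrix S m s = flip_matrix S m s \<otimes>\<^bsub>F2_matrices S\<^esub> z"
    and s: "s \<in> S" "t \<in> S" "{t, s} \<in> coxeter_edges S m" and "v \<in> S"
  shows "z s v = of_bool (s = v)"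
proof -
  \<comment> \<open>Compare the entries (t, v) of both products: one side is \<open>z t v\<close>,
    the other is \<open>z t v + z s v\<close> because t is a neighbour of s.\<close>
  have off: "z s v = 0" if "v \<in> S" "v \<noteq> s" for v
    using flip_matrix_mult_left[of s t v z] flip_matrix_mult_right[of t v s z] comm s that by simp
  obtain y where "z \<otimes>\<^bsub>F2_matrices S\<^esub> y = \<one>\<^bsub>F2_matrices S\<^esub>"
    using z by (auto simp: Units_def)
  then have "(z \<otimes>\<^bsub>F2_matrices S\<^esub> y) s s = 1"
    using s by (simp add: F2_matrices_simps)
  then have "(\<Sum>x\<in>S. z s x * y x s) = 1"
    using s by (simp add: F2_matrices_simps)
  \<comment> \<open>A zero on the diagonal would make all of row s of \<open>z\<close> vanish, which
    contradicts the right inverse \<open>y\<close>. Over F_2 the diagonal entry is then 1.\<close>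
  moreover have "(\<Sum>x\<in>S. z s x * y x s) = 0" if "z s s = 0"
    using off that by (intro sum.neutral) auto
  ultimately have "z s s = 1"
    by (cases "z s s") auto
  with off \<open>v \<in> S\<close> show ?thesis by auto
qed

lemma flipping_group_simps:
  "carrier (flipping_group S m) = generate (GL_F2 S) (flip_matrix S m ` S)"
  "A \<otimes>\<^bsub>flipping_group S m\<^esub> B = A \<otimes>\<^bsub>F2_matrices S\<^esub> B"
  "\<one>\<^bsub>flipping_group S m\<^esub> = \<one>\<^bsub>F2_matrices S\<^esub>"
  by (simp_all add: flipping_group_def GL_F2_simps)

lemma center_flipping_group:
  "group_center (flipping_group S m) = {\<one>\<^bsub>flipping_group S m\<^esub>}"
proof (intro equalityI subsetI)
  fix z assume "z \<in> group_center (flipping_group S m)"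
  then have z: "z \<in> generate (GL_F2 S) (flip_matrix S m ` S)"
    and "\<forall>x \<in> generate (GL_F2 S) (flip_matrix S m ` S).
      z \<otimes>\<^bsub>F2_matrices S\<^esub> x = x \<otimes>\<^bsub>F2_matrices S\<^esub> z"
    by (auto simp: group_center_def flipping_group_simps)
  then have comm: "z \<otimes>\<^bsub>F2_matrices S\<^esub> flip_matrix S m s = flip_matrix S m s \<otimes>\<^bsub>F2_matrices S\<^esub> z"
      if "s \<in> S" for s
    using that by (simp add: generate.incl)
  have unit: "z \<in> Units (F2_matrices S)"
    using z flipping_group_subset_Units by blast
  have "z u v = of_bool (u = v)" if "u \<in> S" "v \<in> S" for u v
    \<comment> \<open>Either \<open>u\<close> has no neighbour, or some neighbour of
      \<open>u\<close> serves as the vertex t of \<open>nonisolated_row\<close>;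
      \<open>insert_commute\<close> matches the two ways of writing the edge.\<close>
    using isolated_row[OF z, of u v] nonisolated_row[OF unit comm, of u _ v] that
    by (metis insert_commute)
  moreover have "z \<in> carrier (F2_matrices S)"
    using unit by (auto simp: Units_def)
  ultimately have "z = \<one>\<^bsub>F2_matrices S\<^esub>"
    by (intro F2_matrices_eqI) (auto simp: F2_matrices_simps)
  then show "z \<in> {\<one>\<^bsub>flipping_group S m\<^esub>}"
    by (simp add: flipping_group_simps)
next
  fix z assume "z \<in> {\<one>\<^bsub>flipping_group S m\<^esub>}"
  then have z: "z = \<one>\<^bsub>F2_matrices S\<^esub>"
    by (simp add: flipping_group_simps)
  \<comment> \<open>The unit laws hold only for extensional matrices, so the group elements must
    first be placed in the carrier of the matrix monoid.\<close>
  moreover have "x \<in> carrier (F2_matrices S)" if "x \<in> carrier (flipping_group S m)" for x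
    using that flipping_group_subset_Units by (auto simp: flipping_group_simps Units_def)
  moreover have "\<one>\<^bsub>F2_matrices S\<^esub> \<in> carrier (flipping_group S m)"
    using generate.one[of "GL_F2 S"] by (simp add: flipping_group_simps GL_F2_simps)
  ultimately show "z \<in> group_center (flipping_group S m)"
    using monoid.l_one[OF monoid_F2_matrices[OF finite_gens]]
      monoid.r_one[OF monoid_F2_matrices[OF finite_gens]]
    by (simp add: group_center_def flipping_group_simps)
qed

end

theorem proposition4p1:
  fixes W :: "('a, 'b) monoid_scheme" and S :: "'a set" and m :: "'a \<Rightarrow> 'a \<Rightarrow> nat"
  assumes "simply_laced_coxeter_group W S m"
  shows "group_center (flipping_group S m) = {\<one>\<^bsub>flipping_group S m\<^esub>}"
  using assms by (rule simply_laced_coxeter_group.center_flipping_group)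

end
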